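(* Let $q\ge 3$, let $n,d$ be integers with $1\le d\le n$ and $d$ even, put $t=n-d+1$, and suppose that $n\le t+1+\frac{\log t}{\log(q-1)}$. Then $$A_q(n,d)\le \frac{q^{n-1}}{\sum_{i=0}^{\frac{d-2}{2}}\binom{n-1}{i}(q-1)^i}.$$
   Context: $A_q(n,d)$ denotes the maximum number of codewords in a $q$-ary code of length $n$ (a subset of $\Sigma^n$, with $\Sigma=\{0,1,\dots,q-1\}$) in which any two distinct codewords have Hamming distance at least $d$. The Hamming distance of two sequences is the number of positions in which they differ. *)

theory Defs
  imports Complex_Main
begin

definition words :: "nat \<Rightarrow> nat \<Rightarrow> nat list set" where
  "words q n = {x. set x \<subseteq> {0..<q} \<and> length x = n}"

(* Only meant for lists of equal length. *)
definition hamming_dist :: "'a list \<Rightarrow> 'a list \<Rightarrow> nat" where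
  "hamming_dist x y = card {i. i < length x \<and> x ! i \<noteq> y ! i}"

definition codes :: "nat \<Rightarrow> nat \<Rightarrow> nat \<Rightarrow> nat list set set" where
  "codes q n d =
     {C. C \<subseteq> words q n \<and> (\<forall>x\<in>C. \<forall>y\<in>C. x \<noteq> y \<longrightarrow> d \<le> hamming_dist x y)}"

definition max_code_size :: "nat \<Rightarrow> nat \<Rightarrow> nat \<Rightarrow> nat" where
  "max_code_size q n d = Max (card ` codes q n d)"

(* The set of cardinalities is finite and nonempty, so Max is a genuine maximum. *)

lemma finite_words: "finite (words q n)"
  unfolding words_def by (rule finite_lists_length_eq) simp

lemma finite_codes: "finite (codes q n d)"
proof (rule finite_subset)
  show "codes q n d \<subseteq> Pow (words q n)"
    by (auto simp: codes_def)
qed (simp add: finite_words)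

lemma max_code_size_attained: "\<exists>C\<in>codes q n d. card C = max_code_size q n d"
proof -
  have "{} \<in> codes q n d"
    by (simp add: codes_def)
  then have "max_code_size q n d \<in> card ` codes q n d"
    unfolding max_code_size_def by (intro Max_in) (auto simp: finite_codes)
  then show ?thesis
    by force
qed

lemma card_le_max_code_size: "C \<in> codes q n d \<Longrightarrow> card C \<le> max_code_size q n d"
  unfolding max_code_size_def by (simp add: finite_codes)

end

theory Submission
  imports Defs
begin

text \<open>
  Deleting one coordinate of a code of even minimum distance \<open>d\<close> keeps the codewords distinct and
  leaves minimum distance at least \<open>d - 1 = 2 e + 1\<close> with \<open>e = (d - 2) / 2\<close>, so the bound is the
  sphere-packing bound for the punctured code of length \<open>n - 1\<close>.
\<close>

lemma hamming_dist_Nil [simp]: "hamming_dist [] y = 0"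
  by (simp add: hamming_dist_def)

text \<open>Position 0 counts exactly when the heads differ; every other differing position is one
  of the tails, shifted by \<open>Suc\<close>. This makes induction along the words
  possible.\<close>

lemma hamming_dist_Cons [simp]:
  "hamming_dist (a # x) (b # y) = (if a = b then 0 else 1) + hamming_dist x y"
proof -
  let ?D = "{i. i < length x \<and> x ! i \<noteq> y ! i}"
  have "{i. i < length (a # x) \<and> (a # x) ! i \<noteq> (b # y) ! i}
      = (if a = b then {} else {0}) \<union> Suc ` ?D" (is "?L = ?R")
  proof (rule set_eqI)
    show "i \<in> ?L \<longleftrightarrow> i \<in> ?R" for i
      by (cases i) auto
  qed
  then have "hamming_dist (a # x) (b # y) = card ((if a = b then {} else {0}) \<union> Suc ` ?D)"
    unfolding hamming_dist_def by (rule arg_cong)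
  also have "\<dots> = (if a = b then 0 else 1) + card (Suc ` ?D)"
    by (subst card_Un_disjoint) auto
  also have "card (Suc ` ?D) = hamming_dist x y"
    unfolding hamming_dist_def by (rule card_image) simp
  finally show ?thesis .
qed

lemma hamming_dist_self [simp]: "hamming_dist x x = 0"
  by (simp add: hamming_dist_def)

text \<open>Where \<open>x\<close> and \<open>y\<close> differ, \<open>z\<close> cannot agree with
  both. Both distances on the right end in \<open>z\<close>, the form in which a common point of two
  balls supplies them.\<close>

lemma hamming_dist_triangle:
  assumes "length x = length y"
  shows "hamming_dist x y \<le> hamming_dist x z + hamming_dist y z"
proof -
  have "{i. i < length x \<and> x ! i \<noteq> y ! i}
      \<subseteq> {i. i < length x \<and> x ! i \<noteq> z ! i} \<union> {i. i < length y \<and> y ! i \<noteq> z ! i}"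
    using assms by auto
  then have "hamming_dist x y
      \<le> card ({i. i < length x \<and> x ! i \<noteq> z ! i} \<union> {i. i < length y \<and> y ! i \<noteq> z ! i})"
    unfolding hamming_dist_def by (rule card_mono [rotated]) simp
  also have "\<dots> \<le> hamming_dist x z + hamming_dist y z"
    unfolding hamming_dist_def by (rule card_Un_le)
  finally show ?thesis .
qed

lemma words_0: "words q 0 = {[]}"
  by (auto simp: words_def)

lemma Cons_mem_words_iff: "b # y \<in> words q (Suc m) \<longleftrightarrow> b < q \<and> y \<in> words q m"
  by (auto simp: words_def)

lemma words_SucE:
  assumes "z \<in> words q (Suc m)"
  obtains b y where "z = b # y" "b < q" "y \<in> words q m"
  using assms by (cases z) (auto simp: words_def)

lemma card_words: "card (words q n) = q ^ n"
  using card_lists_length_eq [of "{0..<q}" n] by (simp add: words_def)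

text \<open>The length is read off the centre, so an induction on the centre changes both
  together.\<close>

definition sphere :: "nat \<Rightarrow> nat list \<Rightarrow> nat \<Rightarrow> nat list set" where
  "sphere q x i = {y \<in> words q (length x). hamming_dist x y = i}"

lemma finite_sphere: "finite (sphere q x i)"
  by (simp add: sphere_def finite_words)

lemma sphere_Cons_0:
  assumes "a < q"
  shows "sphere q (a # x) 0 = Cons a ` sphere q x 0"
  using assms by (auto simp: sphere_def Cons_mem_words_iff elim!: words_SucE split: if_splits)

text \<open>Split by the first letter: keeping \<open>a\<close> leaves the whole distance to the
  tail, while any other letter uses up one unit of it.\<close>

lemma sphere_Cons_Suc:
  assumes "a < q"
  shows "sphere q (a # x) (Suc i) = Cons a ` sphere q x (Suc i)
      \<union> (\<lambda>(b, y). b # y) ` (({0..<q} - {a}) \<times> sphere q x i)"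
  using assms by (auto simp: sphere_def Cons_mem_words_iff elim!: words_SucE split: if_splits)

text \<open>Choose the \<open>i\<close> positions to alter, then one of the \<open>q - 1\<close>
  other letters at each. The induction on the centre replaces this choice by Pascal's rule.\<close>

lemma card_sphere:
  assumes "set x \<subseteq> {0..<q}"
  shows "card (sphere q x i) = (length x choose i) * (q - 1) ^ i"
  using assms
proof (induction x arbitrary: i)
  case Nil
  have "sphere q [] i = (if i = 0 then {[]} else {})"
    by (auto simp: sphere_def words_0)
  then show ?case
    by (cases i) auto
next
  case (Cons a x)
  then have a: "a < q" and IH: "card (sphere q x i) = (length x choose i) * (q - 1) ^ i" for i
    by auto
  show ?case
  proof (cases i)
    case 0
    then show ?thesis
      using IH [of 0] by (simp add: sphere_Cons_0 a card_image)
  next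
    case (Suc j)
    let ?P = "({0..<q} - {a}) \<times> sphere q x j"
    have "card ((\<lambda>(b, y). b # y) ` ?P) = card ?P"
      by (rule card_image) (auto simp: inj_on_def)
    then have "card ((\<lambda>(b, y). b # y) ` ?P) = (q - 1) * card (sphere q x j)"
      using a by (simp add: card_cartesian_product)
    moreover have "card (Cons a ` sphere q x (Suc j)) = card (sphere q x (Suc j))"
      by (simp add: card_image)
    \<comment> \<open>The first letter tells the two parts apart: it is \<open>a\<close> in one and
      never \<open>a\<close> in the other.\<close>
    moreover have "Cons a ` sphere q x (Suc j) \<inter> (\<lambda>(b, y). b # y) ` ?P = {}"
      by auto
    ultimately have "card (sphere q (a # x) i)
        = card (sphere q x (Suc j)) + (q - 1) * card (sphere q x j)"
      by (simp add: Suc sphere_Cons_Suc a card_Un_disjoint finite_sphere)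
    \<comment> \<open>By the induction hypothesis both summands carry the factor
      \<open>(q - 1) ^ Suc j\<close>, and their binomials add up by Pascal's rule.\<close>
    then show ?thesis
      by (simp add: Suc IH distrib_left distrib_right mult_ac)
  qed
qed

definition hamming_ball :: "nat \<Rightarrow> nat list \<Rightarrow> nat \<Rightarrow> nat list set" where
  "hamming_ball q x e = {y \<in> words q (length x). hamming_dist x y \<le> e}"

lemma card_hamming_ball:
  assumes "set x \<subseteq> {0..<q}"
  shows "card (hamming_ball q x e) = (\<Sum>i = 0..e. (length x choose i) * (q - 1) ^ i)"
proof -
  have "hamming_ball q x e = (\<Union>i\<in>{0..e}. sphere q x i)"
    by (auto simp: hamming_ball_def sphere_def)
  also have "card \<dots> = (\<Sum>i\<in>{0..e}. card (sphere q x i))"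
    by (rule card_UN_disjoint) (auto simp: finite_sphere, auto simp: sphere_def)
  finally show ?thesis
    by (simp add: card_sphere assms)
qed

text \<open>Balls of radius \<open>e\<close> around codewords are pairwise disjoint and equally
  large, and all of them lie in \<open>words q n\<close>.\<close>

lemma sphere_packing_bound:
  assumes "C \<in> codes q n (2 * e + 1)"
  shows "card C * (\<Sum>i = 0..e. (n choose i) * (q - 1) ^ i) \<le> q ^ n"
proof -
  have C: "C \<subseteq> words q n"
    using assms by (simp add: codes_def)
  then have lengths: "length x = n" and letters: "set x \<subseteq> {0..<q}" if "x \<in> C" for x
    using that by (auto simp: words_def)
  have "hamming_ball q x e \<inter> hamming_ball q y e = {}"
    if "x \<in> C" "y \<in> C" "x \<noteq> y" for x y
  proof -
    have "\<not> (hamming_dist x z \<le> e \<and> hamming_dist y z \<le> e)" for z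
    proof -
      have "2 * e + 1 \<le> hamming_dist x y"
        using assms that by (auto simp: codes_def)
      also have "\<dots> \<le> hamming_dist x z + hamming_dist y z"
        using that by (intro hamming_dist_triangle) (simp add: lengths)
      \<comment> \<open>A common point of both balls would give
        \<open>2 * e + 1 \<le> e + e\<close>.\<close>
      finally show ?thesis
        by linarith
    qed
    then show ?thesis
      by (auto simp: hamming_ball_def)
  qed
  then have "card (\<Union>x\<in>C. hamming_ball q x e) = (\<Sum>x\<in>C. card (hamming_ball q x e))"
    using finite_subset [OF C finite_words]
    by (intro card_UN_disjoint) (auto simp: hamming_ball_def finite_words)
  also have "\<dots> = card C * (\<Sum>i = 0..e. (n choose i) * (q - 1) ^ i)"
    by (simp add: card_hamming_ball letters lengths)
  finally have "card C * (\<Sum>i = 0..e. (n choose i) * (q - 1) ^ i)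
      = card (\<Union>x\<in>C. hamming_ball q x e)" ..
  also have "\<dots> \<le> card (words q n)"
    by (rule card_mono) (auto simp: finite_words hamming_ball_def lengths)
  finally show ?thesis
    by (simp add: card_words)
qed

lemma hamming_dist_tl:
  assumes "x \<in> words q (Suc n)" "y \<in> words q (Suc n)"
  shows "hamming_dist x y \<le> Suc (hamming_dist (tl x) (tl y))"
  using assms by (auto elim!: words_SucE)

text \<open>The deleted position accounts for at most one unit of distance. Successors in the
  hypothesis avoid truncated subtraction in the conclusion.\<close>

lemma puncture_code:
  assumes "C \<in> codes q (Suc n) (Suc d)" and "0 < d"
  shows "tl ` C \<in> codes q n d" and "card (tl ` C) = card C"
proof -
  have C: "C \<subseteq> words q (Suc n)"
    using assms by (simp add: codes_def)
  have far: "d \<le> hamming_dist (tl x) (tl y)" if "x \<in> C" "y \<in> C" "x \<noteq> y" for x y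
  proof -
    have "Suc d \<le> hamming_dist x y"
      using assms that by (auto simp: codes_def)
    also have "\<dots> \<le> Suc (hamming_dist (tl x) (tl y))"
      using C that by (intro hamming_dist_tl) auto
    finally show ?thesis
      by simp
  qed
  have "tl ` C \<subseteq> words q n"
    using C by (auto elim!: words_SucE dest!: subsetD)
  with far show "tl ` C \<in> codes q n d"
    by (auto simp: codes_def)
  have "inj_on tl C"
  proof (rule inj_onI, rule ccontr)
    fix x y
    assume "x \<in> C" "y \<in> C" "tl x = tl y" "x \<noteq> y"
    \<comment> \<open>Equal tails have distance 0, but \<open>far\<close> makes it at least
      \<open>d > 0\<close>.\<close>
    then show False
      using far [of x y] assms(2) by simp
  qed
  then show "card (tl ` C) = card C"
    by (rule card_image)
qed

theorem lemma7:
  fixes q n d t :: nat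
  assumes "3 \<le> q"
    and "1 \<le> d" and "d \<le> n" and "even d"
    and "t = n - d + 1"
    and "real n \<le> real t + 1 + ln (real t) / ln (real q - 1)"
  shows "real (max_code_size q n d)
    \<le> real q ^ (n - 1) / (\<Sum>i = 0..(d - 2) div 2. real ((n - 1) choose i) * (real q - 1) ^ i)"
proof -
  define e where "e = (d - 2) div 2"
  \<comment> \<open>An even \<open>d \<ge> 1\<close> is at least 2, so neither \<open>d - 2\<close>
    nor its half loses anything; \<open>n \<ge> d\<close> does the same for
    \<open>n - 1\<close>.\<close>
  have d: "d = Suc (2 * e + 1)" and n: "n = Suc (n - 1)"
    using assms(2-4) by (auto simp: e_def elim!: evenE)
  obtain C where C: "C \<in> codes q n d" and card_C: "card C = max_code_size q n d"
    using max_code_size_attained by blast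
  have "C \<in> codes q (Suc (n - 1)) (Suc (2 * e + 1))"
    using C unfolding d [symmetric] n [symmetric] .
  note punctured = puncture_code [OF this]
  define S where "S = (\<Sum>i = 0..e. ((n - 1) choose i) * (q - 1) ^ i)"
  have "max_code_size q n d * S \<le> q ^ (n - 1)"
    using sphere_packing_bound [OF punctured(1)] punctured(2) card_C by (simp add: S_def)
  then have "real (max_code_size q n d) * real S \<le> real q ^ (n - 1)"
    by (metis of_nat_le_iff of_nat_mult of_nat_power)
  \<comment> \<open>The term for \<open>i = 0\<close> is already 1.\<close>
  moreover have "0 < S"
    by (simp add: S_def sum.atLeast_Suc_atMost)
  ultimately have "real (max_code_size q n d) \<le> real q ^ (n - 1) / real S"
    by (simp add: pos_le_divide_eq)
  also have "real S = (\<Sum>i = 0..e. real ((n - 1) choose i) * (real q - 1) ^ i)"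
    using assms(1) by (simp add: S_def of_nat_diff)
  finally show ?thesis
    by (simp add: e_def)
qed

end
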